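(* Let $\Lambda$ be a countable set and $\beta=(\beta_\lambda)_{\lambda\in\Lambda}$ a real family with $\|\beta\|_{\ell_2}<\infty$, to be estimated. Let $\Gamma\subset\Lambda$ be a known deterministic subset, and assume that a family of coefficient estimators $(\hat\beta_\lambda)_{\lambda\in\Gamma}$ (real random variables) and a family of possibly random thresholds $(\eta_\lambda)_{\lambda\in\Gamma}$ (nonnegative) are available. Consider the thresholding rule $\tilde\beta=(\hat\beta_\lambda1_{|\hat\beta_\lambda|\ge\eta_\lambda}1_{\lambda\in\Gamma})_{\lambda\in\Lambda}$. Let $\varepsilon>0$ be fixed. Assume that there exist a deterministic family $(F_\lambda)_{\lambda\in\Gamma}$ of nonnegative numbers and three constants $\kappa\in(0,1)$, $\omega\in[0,1]$ and $\mu>0$ (that may depend on $\varepsilon$ but not on $\lambda$) with the following properties. (A1) For all $\lambda\in\Gamma$, $$\mathbb{P}(|\hat\beta_\lambda-\beta_\lambda|>\kappa\eta_\lambda)\le\omega.$$ (A2) There exist $1<p,q<\infty$ with $\frac1p+\frac1q=1$ and a constant $R>0$ such that for all $\lambda\in\Gamma$, $$\left(\mathbb{E}(|\hat\beta_\lambda-\beta_\lambda|^{2p})\right)^{1/p}\le R\max\left(F_\lambda,\,F_\lambda^{1/p}\varepsilon^{1/q}\right).$$ (A3) There exists a constant $\theta>0$ such that for all $\lambda\in\Gamma$ with $F_\lambda<\theta\varepsilon$, $$\mathbb{P}(|\hat\beta_\lambda-\beta_\lambda|>\kappa\eta_\lambda,\ |\hat\beta_\lambda|>\eta_\lambda)\le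 F_\lambda\mu .$$ Then the estimator $\tilde\beta$ satisfies $$\frac{1-\kappa^2}{1+\kappa^2}\,\mathbb{E}\|\tilde\beta-\beta\|_{\ell_2}^2\le\mathbb{E}\inf_{m\subset\Gamma}\left\{\frac{1+\kappa^2}{1-\kappa^2}\sum_{\lambda\notin m}\beta_\lambda^2+\frac{1-\kappa^2}{\kappa^2}\sum_{\lambda\in m}(\hat\beta_\lambda-\beta_\lambda)^2+\sum_{\lambda\in m}\eta_\lambda^2\right\}+LD\sum_{\lambda\in\Gamma}F_\lambda$$ with $$LD=\frac{R}{\kappa^2}\left(\left(1+\theta^{-1/q}\right)\omega^{1/q}+\left(1+\theta^{1/q}\right)\varepsilon^{1/q}\mu^{1/q}\right).$$
   Context: The set $\Gamma$ may be infinite. The sum over $\lambda\notin m$ runs over $\lambda\in\Lambda\setminus m$. No assumption is made on the distribution of the $\hat\beta_\lambda$ or on the form of the thresholds $\eta_\lambda$ beyond (A1)–(A3); the result is not tied to a particular statistical model. It is informative only when $\sum_{\lambda\in\Gamma}F_\lambda<\infty$.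
   Formalization: In (A3) the event is |β̂_λ−β_λ|>κη_λ, |β̂_λ|≥η_λ instead of |β̂_λ|>η_λ, since the rule keeps coefficients with |β̂_λ|=η_λ; as printed the bound fails, e.g. for one index with β=0, β̂=η=1, κ²=1/2, p=q=2, ε=θ=μ=ω=1, R=100, F=1/10000. *)

theory Defs
  imports "HOL-Probability.Probability"
begin

text \<open>
  Families indexed by \<open>\<Lambda>\<close> or \<open>\<Gamma>\<close> are total functions on the index type; only their values on
  \<open>\<Lambda>\<close> resp. \<open>\<Gamma>\<close> matter. Quantities that may be infinite (squared norms, the infimum, and the
  expectations of these) live in \<^typ>\<open>ennreal\<close>.
\<close>

definition l2_norm_sq :: "'i set \<Rightarrow> ('i \<Rightarrow> real) \<Rightarrow> ennreal" where
  "l2_norm_sq \<Lambda> b = (\<Sum>\<^sub>\<infinity>l\<in>\<Lambda>. ennreal ((b l)\<^sup>2))"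

text \<open>
  The rule keeps a coefficient with \<open>\<bar>\<beta>h\<bar> = \<eta>\<close>, so the event in the hypothesis on small \<open>F\<close> (A3) must
  include \<open>\<bar>\<beta>h\<bar> = \<eta>\<close> too. With \<open>\<bar>\<beta>h\<bar> > \<eta>\<close> there, the risk bound is false: for one index and the
  constants \<open>\<beta> = 0\<close>, \<open>\<beta>h = \<eta> = 1\<close>, \<open>\<kappa>\<^sup>2 = 1/2\<close>, \<open>p = q = 2\<close>, \<open>\<epsilon> = \<theta> = \<mu> = \<omega> = 1\<close>, \<open>R = 100\<close>,
  \<open>F = 1/10000\<close>, its left side is 1/3, the infimum is 0 and \<open>LD * F = 8/100\<close>.
\<close>

definition threshold_rule ::
  "'i set \<Rightarrow> ('i \<Rightarrow> 'a \<Rightarrow> real) \<Rightarrow> ('i \<Rightarrow> 'a \<Rightarrow> real) \<Rightarrow> 'a \<Rightarrow> 'i \<Rightarrow> real" where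
  "threshold_rule \<Gamma> \<beta>h \<eta> x l = (if l \<in> \<Gamma> \<and> \<bar>\<beta>h l x\<bar> \<ge> \<eta> l x then \<beta>h l x else 0)"

definition oracle_infimum ::
  "real \<Rightarrow> 'i set \<Rightarrow> 'i set \<Rightarrow> ('i \<Rightarrow> real) \<Rightarrow> ('i \<Rightarrow> 'a \<Rightarrow> real) \<Rightarrow> ('i \<Rightarrow> 'a \<Rightarrow> real) \<Rightarrow> 'a \<Rightarrow> ennreal"
where
  "oracle_infimum \<kappa> \<Lambda> \<Gamma> \<beta> \<beta>h \<eta> x =
     (INF m\<in>Pow \<Gamma>.
        ennreal ((1 + \<kappa>\<^sup>2) / (1 - \<kappa>\<^sup>2)) * (\<Sum>\<^sub>\<infinity>l\<in>\<Lambda> - m. ennreal ((\<beta> l)\<^sup>2))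
      + ennreal ((1 - \<kappa>\<^sup>2) / \<kappa>\<^sup>2) * (\<Sum>\<^sub>\<infinity>l\<in>m. ennreal ((\<beta>h l x - \<beta> l)\<^sup>2))
      + (\<Sum>\<^sub>\<infinity>l\<in>m. ennreal ((\<eta> l x)\<^sup>2)))"

definition LD :: "real \<Rightarrow> real \<Rightarrow> real \<Rightarrow> real \<Rightarrow> real \<Rightarrow> real \<Rightarrow> real \<Rightarrow> real" where
  "LD \<kappa> \<omega> \<mu> \<epsilon> R \<theta> q =
     R / \<kappa>\<^sup>2 * ((1 + \<theta> powr (- (1 / q))) * \<omega> powr (1 / q)
              + (1 + \<theta> powr (1 / q)) * \<epsilon> powr (1 / q) * \<mu> powr (1 / q))"

end

theory Submission
  imports Defs
begin

text \<open>
  Both the loss and the oracle bound decouple over the coefficients, so the inequality is proved one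
  coefficient at a time. Minimising the bracket over \<open>m\<close> amounts to choosing, for each
  \<open>l \<in> \<Gamma>\<close> separately, the cheaper of killing the coefficient (cost \<open>(1 + \<kappa>\<^sup>2) / (1 - \<kappa>\<^sup>2) * \<beta>\<^sup>2\<close>)
  and keeping it (cost \<open>(1 - \<kappa>\<^sup>2) / \<kappa>\<^sup>2 * (\<beta>h - \<beta>)\<^sup>2 + \<eta>\<^sup>2\<close>); outside \<open>\<Gamma>\<close> only killing is possible.

  The loss of the thresholding rule is always at most the cost of keeping
  (\<open>keep_or_kill_le_noise\<close>). It is also at most the cost of killing, unless the rule keeps a
  coefficient whose noise \<open>\<bar>\<beta>h - \<beta>\<bar>\<close> exceeds \<open>\<kappa> * \<eta>\<close> (\<open>keep_or_kill_le_signal\<close>): if the noise is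
  smaller, then \<open>\<bar>\<beta>h\<bar> \<ge> \<eta>\<close> forces \<open>\<bar>\<beta>\<bar> \<ge> (1 - \<kappa>) * \<eta>\<close>, so the signal dominates the noise. On the
  remaining bad event the loss is at most \<open>(\<beta>h - \<beta>)\<^sup>2\<close>, and Hoelder's inequality bounds the
  expectation of this square over the event by the \<open>2p\<close>-th moment (\<open>A2\<close>) and the probability of the
  event to the power \<open>1 / q\<close>. That probability is at most \<open>\<omega>\<close> by \<open>A1\<close>, and at most \<open>F * \<mu>\<close> by \<open>A3\<close> if
  \<open>F < \<theta> * \<epsilon>\<close>. In either range of \<open>F\<close> the product is at most \<open>LD * F\<close>
  (\<open>moment_times_probability_le\<close>), which yields the remainder after summation.

  The infimum over the possibly uncountably many sets \<open>m\<close> is never integrated exactly: it is bounded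
  below by the sum of the coefficientwise minima, a countable sum of measurable functions
  (\<open>sum_coefficient_oracle_le_oracle_infimum\<close>).
\<close>

section \<open>Preliminaries on sums and integrals\<close>

text \<open>
  As an integral against the counting measure, an unconditional sum becomes subject to Tonelli's
  theorem and to linearity under multiplication by an extended nonnegative real.
\<close>

lemma infsum_ennreal_eq_nn_integral_count_space:
  fixes f :: "'i \<Rightarrow> ennreal"
  assumes "countable A"
  shows "infsum f A = (\<integral>\<^sup>+l. f l \<partial>count_space A)"
proof (rule antisym)
  have "sum f B \<le> (\<integral>\<^sup>+l. f l \<partial>count_space A)" if "finite B" "B \<subseteq> A" for B
  proof -
    have "sum f B = (\<integral>\<^sup>+l. f l \<partial>count_space B)"
      using that by (simp add: nn_integral_count_space_finite)
    also have "\<dots> \<le> (\<integral>\<^sup>+l. f l \<partial>count_space A)"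
      using that by (auto simp: nn_integral_count_space_indicator intro!: nn_integral_mono
          split: split_indicator)
    finally show ?thesis .
  qed
  then show "infsum f A \<le> (\<integral>\<^sup>+l. f l \<partial>count_space A)"
    by (auto simp: nonneg_infsum_complete intro!: SUP_least)
next
  have fin: "sum f B \<le> infsum f A" if "finite B" "B \<subseteq> A" for B
    using that by (auto simp: nonneg_infsum_complete intro!: SUP_upper)
  show "(\<integral>\<^sup>+l. f l \<partial>count_space A) \<le> infsum f A"
  proof (cases "finite A")
    case True
    then show ?thesis by (simp add: nn_integral_count_space_finite)
  next
    case False
    note bij = bij_betw_from_nat_into[OF assms False]
    have "(\<integral>\<^sup>+l. f l \<partial>count_space A) = (\<Sum>n. f (from_nat_into A n))"
      by (simp add: nn_integral_bij_count_space[OF bij, symmetric] nn_integral_count_space_nat)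
    also have "\<dots> \<le> infsum f A"
    proof (rule suminf_le_const)
      fix n
      have "(\<Sum>i<n. f (from_nat_into A i)) = sum f (from_nat_into A ` {..<n})"
        using bij by (subst sum.reindex) (auto simp: bij_betw_def inj_on_def)
      also have "\<dots> \<le> infsum f A"
        using bij by (intro fin) (auto simp: bij_betw_def)
      finally show "(\<Sum>i<n. f (from_nat_into A i)) \<le> infsum f A" .
    qed simp
    finally show ?thesis .
  qed
qed

text \<open>
  If neither norm vanishes, this is Young's inequality for \<open>f\<close> and \<open>g\<close> divided by their norms,
  integrated. The left side is a Lebesgue integral with values in \<^typ>\<open>ennreal\<close>, so finiteness of
  it is part of the conclusion.
\<close>

lemma Hoelder_inequality:
  fixes f g :: "'a \<Rightarrow> real" and p q :: real
  assumes pq: "1 < p" "1 < q" "1 / p + 1 / q = 1"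
    and f: "\<And>x. x \<in> space M \<Longrightarrow> 0 \<le> f x" "integrable M (\<lambda>x. f x powr p)"
    and g: "\<And>x. x \<in> space M \<Longrightarrow> 0 \<le> g x" "integrable M (\<lambda>x. g x powr q)"
  shows "(\<integral>\<^sup>+x. ennreal (f x * g x) \<partial>M)
    \<le> ennreal ((LINT x|M. f x powr p) powr (1 / p) * (LINT x|M. g x powr q) powr (1 / q))"
proof -
  define A where "A = (LINT x|M. f x powr p)"
  define B where "B = (LINT x|M. g x powr q)"
  have nn: "0 \<le> A" "0 \<le> B"
    by (auto simp: A_def B_def)
  show ?thesis
  proof (cases "A = 0 \<or> B = 0")
    case True
    then have "AE x in M. f x * g x = 0"
    proof
      assume "A = 0"
      then have "AE x in M. f x powr p = 0"
        using f by (simp add: A_def integral_nonneg_eq_0_iff_AE)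
      then show ?thesis by eventually_elim simp
    next
      assume "B = 0"
      then have "AE x in M. g x powr q = 0"
        using g by (simp add: B_def integral_nonneg_eq_0_iff_AE)
      then show ?thesis by eventually_elim simp
    qed
    then have "AE x in M. ennreal (f x * g x) = 0"
      by eventually_elim (metis ennreal_0)
    then have "(\<integral>\<^sup>+x. ennreal (f x * g x) \<partial>M) = (\<integral>\<^sup>+x. 0 \<partial>M)"
      by (rule nn_integral_cong_AE)
    then show ?thesis by simp
  next
    case False
    with nn have pos: "0 < A" "0 < B" by auto
    define a where "a = A powr (1 / p)"
    define b where "b = B powr (1 / q)"
    have ab: "0 < a" "0 < b" "a powr p = A" "b powr q = B"
      using pos pq by (auto simp: a_def b_def powr_powr)
    let ?h = "\<lambda>x. a * b * (f x powr p / (p * A) + g x powr q / (q * B))"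
    have bound: "f x * g x \<le> ?h x" if "x \<in> space M" for x
    proof -
      have "f x / a * (g x / b) \<le> (f x / a) powr p / p + (g x / b) powr q / q"
        using pq ab f(1)[OF that] g(1)[OF that] by (intro Youngs_inequality) auto
      also have "\<dots> = f x powr p / (p * A) + g x powr q / (q * B)"
        using ab f(1)[OF that] g(1)[OF that] by (simp add: powr_divide mult.commute)
      finally show ?thesis
        using ab by (simp add: field_simps)
    qed
    have int: "integrable M ?h"
      using f g by auto
    have "(\<integral>\<^sup>+x. ennreal (f x * g x) \<partial>M) \<le> (\<integral>\<^sup>+x. ennreal (?h x) \<partial>M)"
      using bound by (intro nn_integral_mono ennreal_leI)
    also have "\<dots> = ennreal (LINT x|M. ?h x)"
      using int ab pos pq by (intro nn_integral_eq_integral) auto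
    also have "(LINT x|M. ?h x) = a * b * (A / (p * A) + B / (q * B))"
      using f g by (simp add: A_def B_def)
    also have "\<dots> = a * b"
      using pos pq by (simp add: field_simps)
    finally show ?thesis
      by (simp add: a_def b_def A_def B_def)
  qed
qed

lemma borel_measurable_nn_integral_count_space:
  fixes f :: "'i \<Rightarrow> 'a \<Rightarrow> ennreal"
  assumes "countable I" and "\<And>i. i \<in> I \<Longrightarrow> f i \<in> borel_measurable M"
  shows "(\<lambda>x. \<integral>\<^sup>+i. f i x \<partial>count_space I) \<in> borel_measurable M"
proof -
  interpret sigma_finite_measure "count_space I"
    using assms(1) by (rule sigma_finite_measure_count_space_countable)
  have "(\<lambda>z. f (snd z) (fst z)) \<in> borel_measurable (M \<Otimes>\<^sub>M count_space I)"
    using assms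
    by (intro measurable_compose_countable'[where f = "\<lambda>i z. f i (fst z)" and g = snd and I = I]
        measurable_compose[OF measurable_fst]) auto
  then show ?thesis
    by (intro borel_measurable_nn_integral) (simp add: case_prod_beta')
qed

section \<open>A single coefficient\<close>

text \<open>
  A kept coefficient loses exactly its squared noise. A killed one has \<open>\<bar>b\<bar> \<le> \<bar>h - b\<bar> + e\<close>, and the
  weight in the splitting of the square is chosen to give \<open>e\<^sup>2\<close> the coefficient 1.
\<close>

lemma keep_or_kill_le_noise:
  fixes b h e \<kappa> :: real
  assumes "0 < \<kappa>" "\<kappa> < 1" "0 \<le> e"
  shows "(1 - \<kappa>\<^sup>2) / (1 + \<kappa>\<^sup>2) * ((if e \<le> \<bar>h\<bar> then h else 0) - b)\<^sup>2
    \<le> (1 - \<kappa>\<^sup>2) / \<kappa>\<^sup>2 * (h - b)\<^sup>2 + e\<^sup>2"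
proof -
  have k: "0 < \<kappa>\<^sup>2" "\<kappa>\<^sup>2 < 1" "0 < 1 + \<kappa>\<^sup>2" "1 + \<kappa>\<^sup>2 \<noteq> 0"
    using assms zero_le_power2[of \<kappa>] by (simp_all add: power_less_one_iff add_pos_nonneg add_nonneg_eq_0_iff)
  show ?thesis
  proof (cases "e \<le> \<bar>h\<bar>")
    case True
    have "(1 - \<kappa>\<^sup>2) / (1 + \<kappa>\<^sup>2) * (h - b)\<^sup>2 \<le> (1 - \<kappa>\<^sup>2) / \<kappa>\<^sup>2 * (h - b)\<^sup>2"
      using k by (intro mult_right_mono frac_le) simp_all
    then show ?thesis
      using True by (simp add: add_increasing2)
  next
    case False
    \<comment> \<open>The solution of \<open>(1 - \<kappa>\<^sup>2) / (1 + \<kappa>\<^sup>2) * (1 + 1 / c) = 1\<close>.\<close>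
    define c where "c = (1 - \<kappa>\<^sup>2) / (2 * \<kappa>\<^sup>2)"
    have c: "0 < c" using k by (simp add: c_def)
    have "b\<^sup>2 \<le> (\<bar>h - b\<bar> + e)\<^sup>2"
      using False assms by (intro power2_le_iff_abs_le[THEN iffD2]) auto
    also have "\<dots> \<le> (1 + c) * (h - b)\<^sup>2 + (1 + 1 / c) * e\<^sup>2"
    proof -
      have "0 \<le> (c * \<bar>h - b\<bar> - e)\<^sup>2 / c" using c by simp
      also have "\<dots> = (1 + c) * \<bar>h - b\<bar>\<^sup>2 + (1 + 1 / c) * e\<^sup>2 - (\<bar>h - b\<bar> + e)\<^sup>2"
        using c by (simp add: field_simps power2_eq_square)
      finally show ?thesis by simp
    qed
    finally have "(1 - \<kappa>\<^sup>2) / (1 + \<kappa>\<^sup>2) * b\<^sup>2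
      \<le> (1 - \<kappa>\<^sup>2) / (1 + \<kappa>\<^sup>2) * ((1 + c) * (h - b)\<^sup>2 + (1 + 1 / c) * e\<^sup>2)"
      using k by (intro mult_left_mono) auto
    also have "\<dots> = (1 - \<kappa>\<^sup>2) / (2 * \<kappa>\<^sup>2) * (h - b)\<^sup>2 + e\<^sup>2"
    proof -
      have "(1 - \<kappa>\<^sup>2) / (1 + \<kappa>\<^sup>2) * (1 + c) = (1 - \<kappa>\<^sup>2) / (2 * \<kappa>\<^sup>2)"
        "(1 - \<kappa>\<^sup>2) / (1 + \<kappa>\<^sup>2) * (1 + 1 / c) = 1"
        using k unfolding c_def by (simp_all add: divide_simps)
      then show ?thesis by (metis distrib_left mult.assoc mult_1)
    qed
    also have "\<dots> \<le> (1 - \<kappa>\<^sup>2) / \<kappa>\<^sup>2 * (h - b)\<^sup>2 + e\<^sup>2"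
      using k by (intro add_right_mono mult_right_mono frac_le) simp_all
    finally show ?thesis using False by simp
  qed
qed

text \<open>
  Killing loses \<open>b\<^sup>2\<close>. If the coefficient is kept and its noise is at most \<open>\<kappa> * e\<close>, then
  \<open>\<bar>b\<bar> \<ge> (1 - \<kappa>) * e \<ge> (1 - \<kappa>) / \<kappa> * \<bar>h - b\<bar>\<close>. The inequality is proved for the square roots, where the
  denominators can be cleared.
\<close>

lemma keep_or_kill_le_signal:
  fixes b h e \<kappa> :: real
  assumes "0 < \<kappa>" "\<kappa> < 1"
    and good: "e \<le> \<bar>h\<bar> \<Longrightarrow> \<bar>h - b\<bar> \<le> \<kappa> * e"
  shows "(1 - \<kappa>\<^sup>2) / (1 + \<kappa>\<^sup>2) * ((if e \<le> \<bar>h\<bar> then h else 0) - b)\<^sup>2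
    \<le> (1 + \<kappa>\<^sup>2) / (1 - \<kappa>\<^sup>2) * b\<^sup>2"
proof -
  have k: "0 < \<kappa>\<^sup>2" "\<kappa>\<^sup>2 < 1" "0 < 1 + \<kappa>\<^sup>2" "1 + \<kappa>\<^sup>2 \<noteq> 0"
    using assms zero_le_power2[of \<kappa>] by (simp_all add: power_less_one_iff add_pos_nonneg add_nonneg_eq_0_iff)
  have main: "(1 - \<kappa>\<^sup>2) * \<bar>(if e \<le> \<bar>h\<bar> then h else 0) - b\<bar> \<le> (1 + \<kappa>\<^sup>2) * \<bar>b\<bar>"
  proof (cases "e \<le> \<bar>h\<bar>")
    case True
    have "(1 - \<kappa>) * e \<le> \<bar>b\<bar>"
      using True good[OF True] by (auto simp: algebra_simps)
    have "(1 - \<kappa>\<^sup>2) * \<bar>h - b\<bar> \<le> (1 - \<kappa>\<^sup>2) * (\<kappa> * e)"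
      using good[OF True] k by (intro mult_left_mono) auto
    also have "\<dots> = (1 + \<kappa>) * \<kappa> * ((1 - \<kappa>) * e)"
      by (simp add: algebra_simps power2_eq_square)
    also have "\<dots> \<le> (1 + \<kappa>) * \<kappa> * \<bar>b\<bar>"
      using \<open>(1 - \<kappa>) * e \<le> \<bar>b\<bar>\<close> assms by (intro mult_left_mono) auto
    \<comment> \<open>\<open>\<kappa> < 1\<close> enters as \<open>(1 + \<kappa>) * \<kappa> = \<kappa> + \<kappa>\<^sup>2 \<le> 1 + \<kappa>\<^sup>2\<close>.\<close>
    also have "\<dots> \<le> (1 + \<kappa>\<^sup>2) * \<bar>b\<bar>"
      using assms by (intro mult_right_mono) (auto simp: algebra_simps power2_eq_square)
    finally show ?thesis using True by simp
  next
    case False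
    then show ?thesis using k by (auto intro!: mult_right_mono)
  qed
  have "((1 - \<kappa>\<^sup>2) * \<bar>(if e \<le> \<bar>h\<bar> then h else 0) - b\<bar>)\<^sup>2 \<le> ((1 + \<kappa>\<^sup>2) * \<bar>b\<bar>)\<^sup>2"
    using main k by (intro power_mono) auto
  then have "(1 - \<kappa>\<^sup>2)\<^sup>2 * ((if e \<le> \<bar>h\<bar> then h else 0) - b)\<^sup>2 \<le> (1 + \<kappa>\<^sup>2)\<^sup>2 * b\<^sup>2"
    by (simp only: power_mult_distrib power2_abs)
  moreover have "0 < (1 - \<kappa>\<^sup>2) * (1 + \<kappa>\<^sup>2)"
    using k by simp
  ultimately have "(1 - \<kappa>\<^sup>2)\<^sup>2 * ((if e \<le> \<bar>h\<bar> then h else 0) - b)\<^sup>2 / ((1 - \<kappa>\<^sup>2) * (1 + \<kappa>\<^sup>2))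
    \<le> (1 + \<kappa>\<^sup>2)\<^sup>2 * b\<^sup>2 / ((1 - \<kappa>\<^sup>2) * (1 + \<kappa>\<^sup>2))"
    by (intro divide_right_mono) simp_all
  moreover have "(1 - \<kappa>\<^sup>2)\<^sup>2 * u / ((1 - \<kappa>\<^sup>2) * (1 + \<kappa>\<^sup>2)) = (1 - \<kappa>\<^sup>2) / (1 + \<kappa>\<^sup>2) * u"
    "(1 + \<kappa>\<^sup>2)\<^sup>2 * u / ((1 - \<kappa>\<^sup>2) * (1 + \<kappa>\<^sup>2)) = (1 + \<kappa>\<^sup>2) / (1 - \<kappa>\<^sup>2) * u" for u
    using k by (simp_all add: power2_eq_square[of "1 - \<kappa>\<^sup>2"] power2_eq_square[of "1 + \<kappa>\<^sup>2"])
  ultimately show ?thesis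
    by simp
qed

lemma keep_or_kill_le_min_plus_bad:
  fixes b h e \<kappa> :: real
  assumes k: "0 < \<kappa>" "\<kappa> < 1" and "0 \<le> e"
  shows "(1 - \<kappa>\<^sup>2) / (1 + \<kappa>\<^sup>2) * ((if e \<le> \<bar>h\<bar> then h else 0) - b)\<^sup>2
    \<le> min ((1 + \<kappa>\<^sup>2) / (1 - \<kappa>\<^sup>2) * b\<^sup>2) ((1 - \<kappa>\<^sup>2) / \<kappa>\<^sup>2 * (h - b)\<^sup>2 + e\<^sup>2)
      + (if \<kappa> * e < \<bar>h - b\<bar> \<and> e \<le> \<bar>h\<bar> then (h - b)\<^sup>2 else 0)"
proof (cases "\<kappa> * e < \<bar>h - b\<bar> \<and> e \<le> \<bar>h\<bar>")
  case True
  have k2: "0 < \<kappa>\<^sup>2" "\<kappa>\<^sup>2 < 1" "0 < 1 + \<kappa>\<^sup>2"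
    using k by (simp_all add: power_less_one_iff add_pos_nonneg)
  have "(1 - \<kappa>\<^sup>2) / (1 + \<kappa>\<^sup>2) * (h - b)\<^sup>2 \<le> 1 * (h - b)\<^sup>2"
    using k2 by (intro mult_right_mono) (simp_all add: divide_le_eq_1_pos)
  moreover have "0 \<le> min ((1 + \<kappa>\<^sup>2) / (1 - \<kappa>\<^sup>2) * b\<^sup>2) ((1 - \<kappa>\<^sup>2) / \<kappa>\<^sup>2 * (h - b)\<^sup>2 + e\<^sup>2)"
    using k2 by auto
  ultimately have "(1 - \<kappa>\<^sup>2) / (1 + \<kappa>\<^sup>2) * (h - b)\<^sup>2
    \<le> min ((1 + \<kappa>\<^sup>2) / (1 - \<kappa>\<^sup>2) * b\<^sup>2) ((1 - \<kappa>\<^sup>2) / \<kappa>\<^sup>2 * (h - b)\<^sup>2 + e\<^sup>2) + (h - b)\<^sup>2"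
    by linarith
  then show ?thesis
    using True by (simp only: if_True simp_thms)
next
  case False
  then show ?thesis
    using keep_or_kill_le_noise[OF assms] keep_or_kill_le_signal[OF k, of e h b]
    by (auto simp del: times_divide_eq_left)
qed

text \<open>
  \<open>LD\<close> adds up the bounds of two regimes. For \<open>F \<ge> \<theta> * \<epsilon>\<close>, the scale \<open>\<epsilon>\<close> is at most \<open>F / \<theta>\<close>, so the
  maximum is of order \<open>F\<close> and the crude probability bound \<open>\<omega>\<close> suffices. For \<open>F < \<theta> * \<epsilon>\<close> the
  maximum may be of order \<open>F powr (1 / p)\<close> only, and the bound \<open>F * \<mu>\<close> supplies the missing factor
  \<open>F powr (1 / q)\<close>.
\<close>

lemma moment_times_probability_le:
  fixes F P \<epsilon> \<theta> \<mu> \<omega> p q :: real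
  assumes pq: "1 < p" "1 < q" "1 / p + 1 / q = 1"
    and pos: "0 < \<epsilon>" "0 < \<theta>" "0 < \<mu>" "0 \<le> \<omega>" and F: "0 \<le> F" and P: "0 \<le> P" "P \<le> \<omega>"
    and small: "F < \<theta> * \<epsilon> \<Longrightarrow> P \<le> F * \<mu>"
  shows "max F (F powr (1 / p) * \<epsilon> powr (1 / q)) * P powr (1 / q)
    \<le> ((1 + \<theta> powr (- (1 / q))) * \<omega> powr (1 / q)
        + (1 + \<theta> powr (1 / q)) * \<epsilon> powr (1 / q) * \<mu> powr (1 / q)) * F"
proof -
  have FF: "F powr (1 / p) * F powr (1 / q) = F"
    using F pq by (simp flip: powr_add)
  have max_le: "max x y \<le> x + y" if "0 \<le> x" "0 \<le> y" for x y :: real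
    using that by auto
  let ?u = "(1 + \<theta> powr (- (1 / q))) * \<omega> powr (1 / q)"
  let ?v = "(1 + \<theta> powr (1 / q)) * \<epsilon> powr (1 / q) * \<mu> powr (1 / q)"
  have nn: "0 \<le> ?u * F" "0 \<le> ?v * F"
    using F by auto
  show ?thesis
  proof (cases "F < \<theta> * \<epsilon>")
    case True
    have Fq: "F powr (1 / q) \<le> \<theta> powr (1 / q) * \<epsilon> powr (1 / q)"
      using True F pos pq by (auto simp flip: powr_mult intro!: powr_mono2)
    have "max F (F powr (1 / p) * \<epsilon> powr (1 / q)) * P powr (1 / q)
      \<le> (F + F powr (1 / p) * \<epsilon> powr (1 / q)) * (F * \<mu>) powr (1 / q)"
      using small[OF True] F P pq by (intro mult_mono max_le powr_mono2) auto
    also have "\<dots> = (F * F powr (1 / q) + F powr (1 / p) * F powr (1 / q) * \<epsilon> powr (1 / q))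
      * \<mu> powr (1 / q)"
      using F pos by (simp add: powr_mult algebra_simps)
    also have "\<dots> \<le> (F * (\<theta> powr (1 / q) * \<epsilon> powr (1 / q)) + F * \<epsilon> powr (1 / q)) * \<mu> powr (1 / q)"
      unfolding FF using Fq F by (intro mult_right_mono add_right_mono mult_left_mono) auto
    also have "\<dots> = ?v * F"
      by (simp add: algebra_simps)
    finally show ?thesis using nn by (simp add: distrib_right)
  next
    case False
    then have "\<epsilon> \<le> F / \<theta>"
      using pos by (simp add: field_simps)
    then have "\<epsilon> powr (1 / q) \<le> (F / \<theta>) powr (1 / q)"
      using pos pq by (intro powr_mono2) auto
    also have "\<dots> = F powr (1 / q) * \<theta> powr (- (1 / q))"
      using F pos by (simp add: powr_divide powr_minus_divide)
    finally have eq: "F powr (1 / p) * \<epsilon> powr (1 / q) \<le> F * \<theta> powr (- (1 / q))"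
      by (metis FF mult.assoc mult_left_mono powr_ge_zero)
    have "max F (F powr (1 / p) * \<epsilon> powr (1 / q)) * P powr (1 / q)
      \<le> (F + F powr (1 / p) * \<epsilon> powr (1 / q)) * \<omega> powr (1 / q)"
      using F P pq by (intro mult_mono max_le powr_mono2) auto
    also have "\<dots> \<le> (F + F * \<theta> powr (- (1 / q))) * \<omega> powr (1 / q)"
      using eq by (intro mult_right_mono add_left_mono) auto
    also have "\<dots> = ?u * F"
      by (simp add: algebra_simps)
    finally show ?thesis using nn by (simp add: distrib_right)
  qed
qed

text \<open>
  This is applied to the noise \<open>X = \<beta>h - \<beta>\<close> of a coefficient and the event \<open>B\<close> that the coefficient
  is kept although its noise exceeds \<open>\<kappa> * \<eta>\<close>.
\<close>

lemma nn_integral_square_on_event_le: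
  fixes X :: "'a \<Rightarrow> real" and F \<epsilon> \<kappa> \<theta> \<mu> \<omega> p q R :: real
  assumes M: "prob_space M" and B: "B \<in> sets M"
    and pq: "1 < p" "1 < q" "1 / p + 1 / q = 1"
    and int: "integrable M (\<lambda>x. \<bar>X x\<bar> powr (2 * p))"
    and moment: "(LINT x|M. \<bar>X x\<bar> powr (2 * p)) powr (1 / p)
      \<le> R * max F (F powr (1 / p) * \<epsilon> powr (1 / q))"
    and pos: "0 < \<epsilon>" "0 < \<theta>" "0 < \<mu>" "0 \<le> \<omega>" "0 < R" "0 < \<kappa>" "\<kappa> < 1" "0 \<le> F"
    and prob: "measure M B \<le> \<omega>" "F < \<theta> * \<epsilon> \<Longrightarrow> measure M B \<le> F * \<mu>"
  shows "(\<integral>\<^sup>+x. ennreal ((X x)\<^sup>2 * indicator B x) \<partial>M) \<le> ennreal (LD \<kappa> \<omega> \<mu> \<epsilon> R \<theta> q * F)"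
proof -
  interpret prob_space M by (rule M)
  have sq: "(X x)\<^sup>2 powr p = \<bar>X x\<bar> powr (2 * p)" for x
    using powr_powr[of "\<bar>X x\<bar>" 2 p] by simp
  have ind: "indicator B x powr q = (indicator B x :: real)" for x
    by (simp split: split_indicator)
  have "(\<integral>\<^sup>+x. ennreal ((X x)\<^sup>2 * indicator B x) \<partial>M)
    \<le> ennreal ((LINT x|M. \<bar>X x\<bar> powr (2 * p)) powr (1 / p) * measure M B powr (1 / q))"
    using Hoelder_inequality[of p q M "\<lambda>x. (X x)\<^sup>2" "indicator B"] pq int B
    by (simp add: sq ind less_top[symmetric])
  also have "\<dots> \<le> ennreal (LD \<kappa> \<omega> \<mu> \<epsilon> R \<theta> q * F)"
  proof (rule ennreal_leI)
    let ?T = "(1 + \<theta> powr (- (1 / q))) * \<omega> powr (1 / q)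
        + (1 + \<theta> powr (1 / q)) * \<epsilon> powr (1 / q) * \<mu> powr (1 / q)"
    have "(LINT x|M. \<bar>X x\<bar> powr (2 * p)) powr (1 / p) * measure M B powr (1 / q)
      \<le> R * max F (F powr (1 / p) * \<epsilon> powr (1 / q)) * measure M B powr (1 / q)"
      using moment by (intro mult_right_mono) auto
    also have "\<dots> \<le> R * (?T * F)"
      unfolding mult.assoc[of R] using pos prob pq
      by (intro mult_left_mono moment_times_probability_le) auto
    also have "\<dots> \<le> R / \<kappa>\<^sup>2 * (?T * F)"
    proof (rule mult_right_mono)
      have "0 < \<kappa>\<^sup>2" "\<kappa>\<^sup>2 \<le> 1"
        using pos by (simp_all add: power_le_one)
      then show "R \<le> R / \<kappa>\<^sup>2"
        using pos by (simp add: pos_le_divide_eq mult_left_le)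
      show "0 \<le> ?T * F"
        using pos by simp
    qed
    also have "\<dots> = LD \<kappa> \<omega> \<mu> \<epsilon> R \<theta> q * F"
      by (simp only: LD_def mult.assoc)
    finally show "(LINT x|M. \<bar>X x\<bar> powr (2 * p)) powr (1 / p) * measure M B powr (1 / q)
      \<le> LD \<kappa> \<omega> \<mu> \<epsilon> R \<theta> q * F" .
  qed
  finally show ?thesis .
qed

section \<open>Summing over the coefficients\<close>

text \<open>
  The contribution of a single coefficient to the bracket in \<^const>\<open>oracle_infimum\<close>, minimised over
  whether \<open>l\<close> belongs to \<open>m\<close>.
\<close>

definition coefficient_oracle ::
  "real \<Rightarrow> 'i set \<Rightarrow> ('i \<Rightarrow> real) \<Rightarrow> ('i \<Rightarrow> 'a \<Rightarrow> real) \<Rightarrow> ('i \<Rightarrow> 'a \<Rightarrow> real) \<Rightarrow> 'a \<Rightarrow> 'i \<Rightarrow> real"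
where
  "coefficient_oracle \<kappa> \<Gamma> \<beta> \<beta>h \<eta> x l =
     (let kill = (1 + \<kappa>\<^sup>2) / (1 - \<kappa>\<^sup>2) * (\<beta> l)\<^sup>2;
          keep = (1 - \<kappa>\<^sup>2) / \<kappa>\<^sup>2 * (\<beta>h l x - \<beta> l)\<^sup>2 + (\<eta> l x)\<^sup>2
      in if l \<in> \<Gamma> then min kill keep else kill)"

text \<open>
  For each \<open>m\<close>, the cost of \<open>l\<close> under the choice that \<open>m\<close> prescribes is at least the minimum over
  both choices. The sum of the minima is measurable in the sample point, so that linearity of the
  integral applies to it.
\<close>

lemma sum_coefficient_oracle_le_oracle_infimum:
  assumes "countable \<Lambda>" "\<Gamma> \<subseteq> \<Lambda>" "0 < \<kappa>" "\<kappa> < 1"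
  shows "(\<integral>\<^sup>+l. ennreal (coefficient_oracle \<kappa> \<Gamma> \<beta> \<beta>h \<eta> x l) \<partial>count_space \<Lambda>)
    \<le> oracle_infimum \<kappa> \<Lambda> \<Gamma> \<beta> \<beta>h \<eta> x"
  unfolding oracle_infimum_def
proof (rule INF_greatest)
  fix m assume "m \<in> Pow \<Gamma>"
  then have m: "m \<subseteq> \<Gamma>" "m \<subseteq> \<Lambda>" "countable m" "countable (\<Lambda> - m)"
    using assms by (auto intro: countable_subset)
  have k: "0 < \<kappa>\<^sup>2" "\<kappa>\<^sup>2 < 1" "0 < 1 + \<kappa>\<^sup>2" "1 + \<kappa>\<^sup>2 \<noteq> 0"
    using assms zero_le_power2[of \<kappa>] by (simp_all add: power_less_one_iff add_pos_nonneg add_nonneg_eq_0_iff)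
  let ?J = "\<lambda>l. ennreal (coefficient_oracle \<kappa> \<Gamma> \<beta> \<beta>h \<eta> x l)"
  let ?C = "(1 + \<kappa>\<^sup>2) / (1 - \<kappa>\<^sup>2)" and ?K = "(1 - \<kappa>\<^sup>2) / \<kappa>\<^sup>2"
  have "(\<integral>\<^sup>+l. ?J l \<partial>count_space \<Lambda>)
    = (\<integral>\<^sup>+l. ?J l * indicator (\<Lambda> - m) l + ?J l * indicator m l \<partial>count_space \<Lambda>)"
    by (intro nn_integral_cong) (auto split: split_indicator)
  also have "\<dots> = (\<integral>\<^sup>+l. ?J l * indicator (\<Lambda> - m) l \<partial>count_space \<Lambda>)
      + (\<integral>\<^sup>+l. ?J l * indicator m l \<partial>count_space \<Lambda>)"
    by (intro nn_integral_add) auto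
  also have "(\<integral>\<^sup>+l. ?J l * indicator (\<Lambda> - m) l \<partial>count_space \<Lambda>) = (\<integral>\<^sup>+l. ?J l \<partial>count_space (\<Lambda> - m))"
    by (auto simp: nn_integral_count_space_indicator intro!: nn_integral_cong split: split_indicator)
  also have "(\<integral>\<^sup>+l. ?J l * indicator m l \<partial>count_space \<Lambda>) = (\<integral>\<^sup>+l. ?J l \<partial>count_space m)"
    using m by (auto simp: nn_integral_count_space_indicator intro!: nn_integral_cong split: split_indicator)
  also have "(\<integral>\<^sup>+l. ?J l \<partial>count_space (\<Lambda> - m))
    \<le> (\<integral>\<^sup>+l. ennreal ?C * ennreal ((\<beta> l)\<^sup>2) \<partial>count_space (\<Lambda> - m))"
    using k by (intro nn_integral_mono)
      (auto simp: coefficient_oracle_def Let_def simp flip: ennreal_mult intro!: ennreal_leI)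
  also have "(\<integral>\<^sup>+l. ?J l \<partial>count_space m)
    \<le> (\<integral>\<^sup>+l. ennreal ?K * ennreal ((\<beta>h l x - \<beta> l)\<^sup>2) + ennreal ((\<eta> l x)\<^sup>2) \<partial>count_space m)"
    using m k by (intro nn_integral_mono)
      (auto simp: coefficient_oracle_def Let_def simp flip: ennreal_mult ennreal_plus intro!: ennreal_leI)
  finally show "(\<integral>\<^sup>+l. ?J l \<partial>count_space \<Lambda>) \<le>
      ennreal ?C * (\<Sum>\<^sub>\<infinity>l\<in>\<Lambda> - m. ennreal ((\<beta> l)\<^sup>2))
      + ennreal ?K * (\<Sum>\<^sub>\<infinity>l\<in>m. ennreal ((\<beta>h l x - \<beta> l)\<^sup>2))
      + (\<Sum>\<^sub>\<infinity>l\<in>m. ennreal ((\<eta> l x)\<^sup>2))"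
    using m by (simp add: infsum_ennreal_eq_nn_integral_count_space nn_integral_add nn_integral_cmult
        add.assoc add_mono add_left_mono)
qed

theorem theorem7:
  fixes M :: "'a measure"
    and \<Lambda> \<Gamma> :: "'i set"
    and \<beta> F :: "'i \<Rightarrow> real"
    and \<beta>h \<eta> :: "'i \<Rightarrow> 'a \<Rightarrow> real"
    and \<epsilon> \<kappa> \<omega> \<mu> p q R \<theta> :: real
  assumes "prob_space M"
    and "countable \<Lambda>"
    and "l2_norm_sq \<Lambda> \<beta> < \<infinity>"
    and "\<Gamma> \<subseteq> \<Lambda>"
    and "\<And>l. l \<in> \<Gamma> \<Longrightarrow> \<beta>h l \<in> borel_measurable M"
    and "\<And>l. l \<in> \<Gamma> \<Longrightarrow> \<eta> l \<in> borel_measurable M"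
    and "\<And>l x. l \<in> \<Gamma> \<Longrightarrow> x \<in> space M \<Longrightarrow> 0 \<le> \<eta> l x"
    and "0 < \<epsilon>"
    and "\<And>l. l \<in> \<Gamma> \<Longrightarrow> 0 \<le> F l"
    and "0 < \<kappa>" "\<kappa> < 1" "0 \<le> \<omega>" "\<omega> \<le> 1" "0 < \<mu>"
    and A1: "\<And>l. l \<in> \<Gamma> \<Longrightarrow>
          measure M {x \<in> space M. \<bar>\<beta>h l x - \<beta> l\<bar> > \<kappa> * \<eta> l x} \<le> \<omega>"
    and "1 < p" "1 < q" "1 / p + 1 / q = 1" "0 < R"
    and A2_finite: "\<And>l. l \<in> \<Gamma> \<Longrightarrow> integrable M (\<lambda>x. \<bar>\<beta>h l x - \<beta> l\<bar> powr (2 * p))"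
    and A2: "\<And>l. l \<in> \<Gamma> \<Longrightarrow>
          (LINT x|M. \<bar>\<beta>h l x - \<beta> l\<bar> powr (2 * p)) powr (1 / p)
            \<le> R * max (F l) (F l powr (1 / p) * \<epsilon> powr (1 / q))"
    and "0 < \<theta>"
    and A3: "\<And>l. l \<in> \<Gamma> \<Longrightarrow> F l < \<theta> * \<epsilon> \<Longrightarrow>
          measure M {x \<in> space M. \<bar>\<beta>h l x - \<beta> l\<bar> > \<kappa> * \<eta> l x \<and> \<bar>\<beta>h l x\<bar> \<ge> \<eta> l x} \<le> F l * \<mu>"
  shows "ennreal ((1 - \<kappa>\<^sup>2) / (1 + \<kappa>\<^sup>2))
           * (\<integral>\<^sup>+x. l2_norm_sq \<Lambda> (\<lambda>l. threshold_rule \<Gamma> \<beta>h \<eta> x l - \<beta> l) \<partial>M)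
         \<le> (\<integral>\<^sup>+x. oracle_infimum \<kappa> \<Lambda> \<Gamma> \<beta> \<beta>h \<eta> x \<partial>M)
           + ennreal (LD \<kappa> \<omega> \<mu> \<epsilon> R \<theta> q) * (\<Sum>\<^sub>\<infinity>l\<in>\<Gamma>. ennreal (F l))"
proof -
  interpret prob_space M by fact
  note [measurable] = assms(5,6)
  have k: "0 < \<kappa>\<^sup>2" "\<kappa>\<^sup>2 < 1" "0 < 1 + \<kappa>\<^sup>2" "1 + \<kappa>\<^sup>2 \<noteq> 0"
    using assms zero_le_power2[of \<kappa>] by (simp_all add: power_less_one_iff add_pos_nonneg add_nonneg_eq_0_iff)
  let ?c = "(1 - \<kappa>\<^sup>2) / (1 + \<kappa>\<^sup>2)"
  let ?J = "\<lambda>x l. ennreal (coefficient_oracle \<kappa> \<Gamma> \<beta> \<beta>h \<eta> x l)"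
  define B where
    "B l = {x \<in> space M. \<bar>\<beta>h l x - \<beta> l\<bar> > \<kappa> * \<eta> l x \<and> \<bar>\<beta>h l x\<bar> \<ge> \<eta> l x}" for l
  \<comment> \<open>The squared noise on the bad event \<open>B l\<close> bounds the excess of the loss over the oracle cost.\<close>
  define S where
    "S l x = (if l \<in> \<Gamma> then ennreal ((\<beta>h l x - \<beta> l)\<^sup>2 * indicator (B l) x) else 0)" for l x
  have B [measurable]: "B l \<in> sets M" if "l \<in> \<Gamma>" for l
    using that unfolding B_def by measurable
  have S_meas: "S l \<in> borel_measurable M" for l
    by (cases "l \<in> \<Gamma>") (simp_all add: S_def[abs_def])
  have J_meas: "(\<lambda>x. ?J x l) \<in> borel_measurable M" for l
    by (cases "l \<in> \<Gamma>") (simp_all add: coefficient_oracle_def Let_def)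
  have S_le: "(\<integral>\<^sup>+x. S l x \<partial>M) \<le> ennreal (LD \<kappa> \<omega> \<mu> \<epsilon> R \<theta> q) * ennreal (F l)"
    if l: "l \<in> \<Gamma>" for l
  proof -
    have "measure M (B l) \<le> measure M {x \<in> space M. \<bar>\<beta>h l x - \<beta> l\<bar> > \<kappa> * \<eta> l x}"
      using l by (intro finite_measure_mono) (auto simp: B_def)
    also have "\<dots> \<le> \<omega>"
      by (rule A1[OF l])
    finally have "(\<integral>\<^sup>+x. S l x \<partial>M) \<le> ennreal (LD \<kappa> \<omega> \<mu> \<epsilon> R \<theta> q * F l)"
      unfolding S_def using l assms(9)[OF l] A2_finite[OF l] A2[OF l] A3[OF l, folded B_def] assms
      by (simp only: if_True, intro nn_integral_square_on_event_le) auto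
    also have "\<dots> = ennreal (LD \<kappa> \<omega> \<mu> \<epsilon> R \<theta> q) * ennreal (F l)"
      using assms(9)[OF l] by (rule ennreal_mult'')
    finally show ?thesis .
  qed
  have pointwise: "ennreal ?c * ennreal ((threshold_rule \<Gamma> \<beta>h \<eta> x l - \<beta> l)\<^sup>2) \<le> ?J x l + S l x"
    if x: "x \<in> space M" for x l
  proof (cases "l \<in> \<Gamma>")
    case True
    let ?s = "if \<kappa> * \<eta> l x < \<bar>\<beta>h l x - \<beta> l\<bar> \<and> \<eta> l x \<le> \<bar>\<beta>h l x\<bar> then (\<beta>h l x - \<beta> l)\<^sup>2 else 0"
    have "?c * (threshold_rule \<Gamma> \<beta>h \<eta> x l - \<beta> l)\<^sup>2 \<le> coefficient_oracle \<kappa> \<Gamma> \<beta> \<beta>h \<eta> x l + ?s"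
      using keep_or_kill_le_min_plus_bad[of \<kappa> "\<eta> l x" "\<beta>h l x" "\<beta> l"] True x assms(7,10,11)
      by (simp add: threshold_rule_def coefficient_oracle_def Let_def del: times_divide_eq_left)
    moreover have "S l x = ennreal ?s"
      using True x by (simp add: S_def B_def)
    moreover have "0 \<le> coefficient_oracle \<kappa> \<Gamma> \<beta> \<beta>h \<eta> x l"
      using k by (simp add: coefficient_oracle_def Let_def)
    ultimately show ?thesis
      using k by (simp add: ennreal_leI del: times_divide_eq_left flip: ennreal_mult ennreal_plus)
  next
    case False
    then have "?c * (threshold_rule \<Gamma> \<beta>h \<eta> x l - \<beta> l)\<^sup>2 \<le> coefficient_oracle \<kappa> \<Gamma> \<beta> \<beta>h \<eta> x l"
      \<comment> \<open>A coefficient outside \<open>\<Gamma>\<close> is killed, as by threshold 1 on the observation 0.\<close>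
      using keep_or_kill_le_signal[of \<kappa> 1 0 "\<beta> l"] assms(10,11)
      by (simp add: threshold_rule_def coefficient_oracle_def)
    then show ?thesis
      using False k by (simp add: S_def ennreal_leI del: times_divide_eq_left flip: ennreal_mult)
  qed
  have t_meas: "(\<lambda>x. ennreal ((threshold_rule \<Gamma> \<beta>h \<eta> x l - \<beta> l)\<^sup>2)) \<in> borel_measurable M" for l
    by (cases "l \<in> \<Gamma>") (simp_all add: threshold_rule_def)
  note sum_meas = borel_measurable_nn_integral_count_space[OF assms(2)]
  have "ennreal ?c * (\<integral>\<^sup>+x. l2_norm_sq \<Lambda> (\<lambda>l. threshold_rule \<Gamma> \<beta>h \<eta> x l - \<beta> l) \<partial>M)
    = (\<integral>\<^sup>+x. (\<integral>\<^sup>+l. ennreal ?c * ennreal ((threshold_rule \<Gamma> \<beta>h \<eta> x l - \<beta> l)\<^sup>2)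
      \<partial>count_space \<Lambda>) \<partial>M)"
    using assms(2) t_meas
    by (simp add: l2_norm_sq_def infsum_ennreal_eq_nn_integral_count_space nn_integral_cmult sum_meas)
  also have "\<dots> \<le> (\<integral>\<^sup>+x. (\<integral>\<^sup>+l. ?J x l \<partial>count_space \<Lambda>) + (\<integral>\<^sup>+l. S l x \<partial>count_space \<Lambda>) \<partial>M)"
    using pointwise by (simp flip: nn_integral_add) (intro nn_integral_mono, simp)
  also have "\<dots> = (\<integral>\<^sup>+x. (\<integral>\<^sup>+l. ?J x l \<partial>count_space \<Lambda>) \<partial>M)
      + (\<integral>\<^sup>+x. (\<integral>\<^sup>+l. S l x \<partial>count_space \<Lambda>) \<partial>M)"
    using J_meas S_meas by (intro nn_integral_add sum_meas)
  also have "\<dots> \<le> (\<integral>\<^sup>+x. oracle_infimum \<kappa> \<Lambda> \<Gamma> \<beta> \<beta>h \<eta> x \<partial>M)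
      + ennreal (LD \<kappa> \<omega> \<mu> \<epsilon> R \<theta> q) * (\<Sum>\<^sub>\<infinity>l\<in>\<Gamma>. ennreal (F l))"
  proof (rule add_mono)
    show "(\<integral>\<^sup>+x. (\<integral>\<^sup>+l. ?J x l \<partial>count_space \<Lambda>) \<partial>M) \<le> (\<integral>\<^sup>+x. oracle_infimum \<kappa> \<Lambda> \<Gamma> \<beta> \<beta>h \<eta> x \<partial>M)"
      using assms(2,4,10,11) by (intro nn_integral_mono sum_coefficient_oracle_le_oracle_infimum)
    have "(\<integral>\<^sup>+x. (\<integral>\<^sup>+l. S l x \<partial>count_space \<Lambda>) \<partial>M) = (\<integral>\<^sup>+l. (\<integral>\<^sup>+x. S l x \<partial>M) \<partial>count_space \<Lambda>)"
      using assms(2) S_meas by (rule nn_integral_count_space_nn_integral)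
    also have "\<dots> = (\<integral>\<^sup>+l. (\<integral>\<^sup>+x. S l x \<partial>M) \<partial>count_space \<Gamma>)"
      using assms(4) by (intro nn_integral_count_space_eq) (auto simp: S_def)
    also have "\<dots> \<le> (\<integral>\<^sup>+l. ennreal (LD \<kappa> \<omega> \<mu> \<epsilon> R \<theta> q) * ennreal (F l) \<partial>count_space \<Gamma>)"
      using S_le by (intro nn_integral_mono) simp
    also have "\<dots> = ennreal (LD \<kappa> \<omega> \<mu> \<epsilon> R \<theta> q) * (\<Sum>\<^sub>\<infinity>l\<in>\<Gamma>. ennreal (F l))"
      using countable_subset[OF assms(4,2)]
      by (simp add: nn_integral_cmult infsum_ennreal_eq_nn_integral_count_space)
    finally show "(\<integral>\<^sup>+x. (\<integral>\<^sup>+l. S l x \<partial>count_space \<Lambda>) \<partial>M)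
      \<le> ennreal (LD \<kappa> \<omega> \<mu> \<epsilon> R \<theta> q) * (\<Sum>\<^sub>\<infinity>l\<in>\<Gamma>. ennreal (F l))" .
  qed
  finally show ?thesis .
qed

end
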